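(* Fix $\delta \in [0,1)$ and $\mu \in \mathcal{D}$. Let $u_\mu \in X$ be the solution of $\mathcal{L}_\mu u_\mu = f_\mu$, let $u_\mu^h \in X^h$ be a discrete approximation of $u_\mu$ with residual $r_\mu^h := f_\mu - \mathcal{L}_\mu u_\mu^h$ and error $e_\mu^h := u_\mu - u_\mu^h$. Let $\hat e_\mu^h \in Z^h$, $\hat e_\mu^h \neq 0$, be any approximation of the error $e_\mu^h$, and let $\rho_\mu^h := r_\mu^h - \mathcal{L}_\mu \hat e_\mu^h$ be the auxiliary residual. Set $$M^h(\mu) := \|\hat e_\mu^h\|_X + \frac{\|\rho_\mu^h\|_Y}{\sqrt{\alpha(\mu)}}.$$ If $$\frac{\|\rho_\mu^h\|_Y}{\sqrt{\alpha(\mu)}\,\|\hat e_\mu^h\|_X} \leq \delta,$$ then $$\frac{M^h(\mu)}{\|e_\mu^h\|_X} \leq \frac{1+\delta}{1-\delta}.$$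
   Context: $X$ and $Y$ are (real) Hilbert spaces and $\mathcal{D} \subset \mathbb{R}^P$ ($P \geq 1$) is compact. For every $\mu \in \mathcal{D}$, $\mathcal{L}_\mu : X \to Y$ is a linear operator, $f_\mu \in Y$ is given, and there are constants $0 < \alpha(\mu) \leq \gamma(\mu) < \infty$ such that $$\alpha(\mu)\|v\|_X^2 \leq \|\mathcal{L}_\mu v\|_Y^2 \leq \gamma(\mu)\|v\|_X^2 \quad \text{for all } v \in X.$$ $X^h \subset X$ and $Z^h \subset X$ are finite-dimensional subspaces (no relation between them is assumed). The words "discrete approximation" and "approximation of the error" impose no condition: $u_\mu^h$ is an arbitrary element of $X^h$ and $\hat e_\mu^h$ is an arbitrary (nonzero) element of $Z^h$. *)

theory Defs
  imports "HOL-Analysis.Analysis"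
begin

definition finite_dim_subspace :: "'a::real_vector set \<Rightarrow> bool" where
  "finite_dim_subspace S \<longleftrightarrow> subspace S \<and> (\<exists>B. finite B \<and> span B = S)"

end

(* The auxiliary residual is L (e - ehat), so coercivity bounds the distance of ehat to e by
   t = norm rho / sqrt alpha. The hypothesis is t <= delta * norm ehat, hence
   M <= (1 + delta) * norm ehat, while the reverse triangle inequality gives
   norm e >= (1 - delta) * norm ehat > 0. *)
theory Submission
  imports Defs
begin

theorem theorem2p1:
  fixes D :: "(real ^ 'p) set"
    and L :: "real ^ 'p \<Rightarrow> 'x::{real_inner, complete_space} \<Rightarrow> 'y::{real_inner, complete_space}"
    and f :: "real ^ 'p \<Rightarrow> 'y"
    and \<alpha> \<gamma> :: "real ^ 'p \<Rightarrow> real"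
    and Xh Zh :: "'x set"
    and \<delta> :: real
    and \<mu> :: "real ^ 'p"
    and u uh e ehat :: 'x
    and r \<rho> :: 'y
    and M :: real
  defines "r \<equiv> f \<mu> - L \<mu> uh"
    and "e \<equiv> u - uh"
    and "\<rho> \<equiv> r - L \<mu> ehat"
    and "M \<equiv> norm ehat + norm \<rho> / sqrt (\<alpha> \<mu>)"
  assumes "compact D"
    and "\<And>\<nu>. \<nu> \<in> D \<Longrightarrow> linear (L \<nu>)"
    and "\<And>\<nu>. \<nu> \<in> D \<Longrightarrow> 0 < \<alpha> \<nu> \<and> \<alpha> \<nu> \<le> \<gamma> \<nu>"
    and "\<And>\<nu> v. \<nu> \<in> D \<Longrightarrow>
           \<alpha> \<nu> * (norm v)\<^sup>2 \<le> (norm (L \<nu> v))\<^sup>2 \<and> (norm (L \<nu> v))\<^sup>2 \<le> \<gamma> \<nu> * (norm v)\<^sup>2"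
    and "finite_dim_subspace Xh"
    and "finite_dim_subspace Zh"
    and "0 \<le> \<delta>" and "\<delta> < 1"
    and "\<mu> \<in> D"
    and "L \<mu> u = f \<mu>"
    and "uh \<in> Xh"
    and "ehat \<in> Zh" and "ehat \<noteq> 0"
    and "norm \<rho> / (sqrt (\<alpha> \<mu>) * norm ehat) \<le> \<delta>"
  shows "e \<noteq> 0 \<and> M / norm e \<le> (1 + \<delta>) / (1 - \<delta>)"
proof -
  define t where "t = norm \<rho> / sqrt (\<alpha> \<mu>)"
  have lin: "linear (L \<mu>)" and \<alpha>: "0 < \<alpha> \<mu>"
    using assms(6,7) \<open>\<mu> \<in> D\<close> by auto
  have ehat: "0 < norm ehat"
    using \<open>ehat \<noteq> 0\<close> by simp
  \<comment> \<open>Since \<open>L \<mu> u = f \<mu>\<close>, linearity turns the residual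
    \<open>r\<close> into \<open>L \<mu> e\<close>.\<close>
  have "\<rho> = L \<mu> (e - ehat)"
    unfolding \<rho>_def r_def e_def \<open>L \<mu> u = f \<mu>\<close>[symmetric] by (simp add: linear_diff[OF lin])
  \<comment> \<open>Lower stability bound at \<open>v = e - ehat\<close>, with
    \<open>\<alpha> \<mu>\<close> absorbed into the square so that roots can be taken next.\<close>
  then have "(sqrt (\<alpha> \<mu>) * norm (e - ehat))\<^sup>2 \<le> (norm \<rho>)\<^sup>2"
    using assms(8)[OF \<open>\<mu> \<in> D\<close>, of "e - ehat"] \<alpha> by (simp add: power_mult_distrib)
  then have "sqrt (\<alpha> \<mu>) * norm (e - ehat) \<le> norm \<rho>"
    by (rule power2_le_imp_le) simp
  then have dist: "norm (e - ehat) \<le> t"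
    using \<alpha> by (simp add: t_def pos_le_divide_eq mult.commute)
  have "t / norm ehat \<le> \<delta>"
    using assms(18) by (simp add: t_def)
  then have t: "t \<le> \<delta> * norm ehat"
    using ehat by (simp add: pos_divide_le_eq)
  have pos: "0 < (1 - \<delta>) * norm ehat"
    using ehat \<open>\<delta> < 1\<close> by simp
  have lower: "(1 - \<delta>) * norm ehat \<le> norm e"
    using dist t norm_triangle_ineq2[of ehat e] by (simp add: norm_minus_commute algebra_simps)
  have "M \<le> (1 + \<delta>) * norm ehat"
    using t by (simp add: M_def t_def algebra_simps)
  \<comment> \<open>The numerator grows and the denominator shrinks but stays positive;
    \<open>0 \<le> \<delta>\<close> keeps the new numerator nonnegative.\<close>
  then have "M / norm e \<le> ((1 + \<delta>) * norm ehat) / ((1 - \<delta>) * norm ehat)"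
    using lower pos \<open>0 \<le> \<delta>\<close> by (intro frac_le) auto
  also have "\<dots> = (1 + \<delta>) / (1 - \<delta>)"
    using ehat by simp
  \<comment> \<open>\<open>lower\<close> and \<open>pos\<close> force \<open>norm e > 0\<close>, so
    the quotient is a genuine one and not the default value 0 of division by zero.\<close>
  finally show ?thesis
    using lower pos by auto
qed

end
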